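(* Let $|\psi\rangle$ be a pure three-qubit state and let $i\neq j$, $i,j\in\{A,B,C\}$. If $\mathcal C_{ij}^2>\frac49$, then the reduced state $\rho_{ij}$ violates the three-settings CJWR linear steering inequality, i.e. $S_{ij}>1$.
   Context: For a two-qubit state $\rho$ let $t_{kl}=\mathrm{Tr}[\rho\,\sigma_k\otimes\sigma_l]$ ($\sigma_k$ Pauli matrices) and $S(\rho)=\sum_{k,l=1}^3 t_{kl}^2$; $\rho_{ij}$ is the two-qubit reduced state of qubits $i,j$ and $S_{ij}=S(\rho_{ij})$. $\mathcal C_{ij}$ is the Wootters concurrence of $\rho_{ij}$: $\mathcal C(\rho)=\max\{0,\lambda_1-\lambda_2-\lambda_3-\lambda_4\}$, with $\lambda_1\ge\dots\ge\lambda_4$ the square roots of the eigenvalues of $\rho(\sigma_2\otimes\sigma_2)\rho^*(\sigma_2\otimes\sigma_2)$. The three-settings CJWR inequality $\frac1{\sqrt3}|\sum_{k=1}^3\langle A_k\otimes B_k\rangle|\le1$ ($A_k=\hat a_k\cdot\vec\sigma$ with unit $\hat a_k$, $B_k=\hat b_k\cdot\vec\sigma$ with orthonormal $\hat b_k$) has maximum $\sqrt{S(\rho)}$ over settings, so it is violated iff $S(\rho)>1$. *)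

theory Defs
  imports "Jordan_Normal_Form.Char_Poly" "HOL-Computational_Algebra.Fundamental_Theorem_Algebra"
begin

(* Pauli matrices sigma_1, sigma_2, sigma_3 (index 0 is unused: identity) *)
definition pauli :: "nat \<Rightarrow> complex mat" where
  "pauli k = (if k = 1 then mat_of_rows_list 2 [[0, 1], [1, 0]]
              else if k = 2 then mat_of_rows_list 2 [[0, -\<i>], [\<i>, 0]]
              else if k = 3 then mat_of_rows_list 2 [[1, 0], [0, -1]]
              else 1\<^sub>m 2)"

definition kron :: "complex mat \<Rightarrow> complex mat \<Rightarrow> complex mat" where
  "kron A B = mat (dim_row A * dim_row B) (dim_col A * dim_col B)
     (\<lambda>(r, s). A $$ (r div dim_row B, s div dim_col B) * B $$ (r mod dim_row B, s mod dim_col B))"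

definition mtrace :: "complex mat \<Rightarrow> complex" where
  "mtrace A = (\<Sum>k<dim_row A. A $$ (k, k))"

(* correlation tensor t_kl = Tr[rho sigma_k \<otimes> sigma_l] (real for Hermitian rho) *)
definition corr :: "complex mat \<Rightarrow> nat \<Rightarrow> nat \<Rightarrow> real" where
  "corr \<rho> k l = Re (mtrace (\<rho> * kron (pauli k) (pauli l)))"

definition S_val :: "complex mat \<Rightarrow> real" where
  "S_val \<rho> = (\<Sum>k\<in>{1..3}. \<Sum>l\<in>{1..3}. (corr \<rho> k l)\<^sup>2)"

definition spin_flip_prod :: "complex mat \<Rightarrow> complex mat" where
  "spin_flip_prod \<rho> = \<rho> * kron (pauli 2) (pauli 2) * map_mat cnj \<rho> * kron (pauli 2) (pauli 2)"

(* lambda_i: square roots of the eigenvalues (with multiplicity) of R, sorted ascending;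
   these eigenvalues are real and nonnegative, hence Re is harmless *)
definition wootters_lambdas :: "complex mat \<Rightarrow> real list" where
  "wootters_lambdas \<rho> =
     sorted_list_of_multiset (image_mset (\<lambda>z. sqrt (Re z)) (proots (char_poly (spin_flip_prod \<rho>))))"

(* C = max{0, l1 - l2 - l3 - l4} with l1 >= ... >= l4; list is ascending *)
definition concurrence :: "complex mat \<Rightarrow> real" where
  "concurrence \<rho> = (let l = wootters_lambdas \<rho> in max 0 (l!3 - l!2 - l!1 - l!0))"

(* three qubits A,B,C = 0,1,2; basis index of |x_0 x_1 x_2> is 4 x_0 + 2 x_1 + x_2 *)
definition idx3 :: "nat \<Rightarrow> nat \<Rightarrow> nat \<Rightarrow> nat \<Rightarrow> nat \<Rightarrow> nat" where
  "idx3 i j a b c = a * 2 ^ (2 - i) + b * 2 ^ (2 - j) + c * 2 ^ (2 - (3 - i - j))"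

definition pure_three_qubit :: "complex vec \<Rightarrow> bool" where
  "pure_three_qubit \<psi> \<longleftrightarrow> dim_vec \<psi> = 8 \<and> (\<Sum>k<8. (cmod (\<psi> $ k))\<^sup>2) = 1"

(* reduced state of qubits i (first factor) and j (second factor): partial trace of |psi><psi|
   over the remaining qubit *)
definition reduced2 :: "complex vec \<Rightarrow> nat \<Rightarrow> nat \<Rightarrow> complex mat" where
  "reduced2 \<psi> i j = mat 4 4 (\<lambda>(r, s). \<Sum>c<2.
      \<psi> $ idx3 i j (r div 2) (r mod 2) c * cnj (\<psi> $ idx3 i j (s div 2) (s mod 2) c))"

end

theory Submission
  imports Defs
begin

text \<open>
  Tracing out one qubit leaves \<open>\<rho> = U U\<^sup>\<dagger>\<close>, where the two columns \<open>u\<^sub>0, u\<^sub>1\<close> of the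
  \<open>4 \<times> 2\<close> matrix \<open>U\<close> are the amplitudes for the two values of the traced-out qubit. With
  \<open>Y = \<sigma>\<^sub>2 \<otimes> \<sigma>\<^sub>2\<close> and \<open>M = U\<^sup>T Y U\<close>, the nonzero eigenvalues of \<open>\<rho> Y \<rho>\<^sup>* Y\<close> are eigenvalues of
  \<open>M\<^sup>\<dagger> M\<close>. Hence the squared concurrence is at most the squared Frobenius norm \<open>T\<close> of \<open>M\<close>, and the
  concurrence is at most the operator norm of \<open>M\<close>, which is at most the largest eigenvalue
  \<open>(1 + c) / 2\<close> of \<open>U\<^sup>\<dagger> U\<close>, where \<open>c\<close> is the length of the Bloch vector of the traced-out qubit.
  On the other hand \<open>S = 2 T + c\<^sup>2\<close>. If the concurrence exceeds \<open>2/3\<close>, then \<open>T > 4/9\<close> and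
  \<open>c > 1/3\<close>, so \<open>S > 8/9 + 1/9\<close>.
\<close>

section \<open>Spin-flip form, matrices of rank at most two, and Pauli entries\<close>

lemma sum_lessThan_4: "(\<Sum>k<(4::nat). f k) = f 0 + f 1 + f 2 + (f 3 :: 'a :: comm_monoid_add)"
  by (simp add: eval_nat_numeral ac_simps)

lemma sum_lessThan_2: "(\<Sum>k<(2::nat). f k) = f 0 + (f 1 :: 'a :: comm_monoid_add)"
  by (simp add: eval_nat_numeral ac_simps)

text \<open>The matrix \<open>\<sigma>\<^sub>2 \<otimes> \<sigma>\<^sub>2\<close> is antidiagonal, with entry \<open>flip_sign r\<close> in row \<open>r\<close>.\<close>

definition flip_sign :: "nat \<Rightarrow> real" where
  "flip_sign r = (if r = 0 \<or> r = 3 then -1 else 1)"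

text \<open>The bilinear form v^T Y w, without conjugation; the entries of M are
  \<open>spin_form (u c) (u d)\<close>.\<close>

definition spin_form :: "(nat \<Rightarrow> complex) \<Rightarrow> (nat \<Rightarrow> complex) \<Rightarrow> complex" where
  "spin_form v w = (\<Sum>r<4. of_real (flip_sign r) * v r * w (3 - r))"

definition overlap :: "(nat \<Rightarrow> complex) \<Rightarrow> (nat \<Rightarrow> complex) \<Rightarrow> complex" where
  "overlap v w = (\<Sum>r<4. cnj (v r) * w r)"

definition mix :: "(nat \<Rightarrow> nat \<Rightarrow> complex) \<Rightarrow> complex mat" where
  "mix u = mat 4 4 (\<lambda>(r, s). \<Sum>c<2. u c r * cnj (u c s))"

lemma spin_form_eq: "spin_form v w = v 1 * w 2 + v 2 * w 1 - v 0 * w 3 - v 3 * w 0"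
  by (simp add: spin_form_def sum_lessThan_4 flip_sign_def)

lemma mix_carrier [simp]: "mix u \<in> carrier_mat 4 4"
  by (simp add: mix_def)

lemma index_mix: "r < 4 \<Longrightarrow> s < 4 \<Longrightarrow> mix u $$ (r, s) = (\<Sum>c<2. u c r * cnj (u c s))"
  by (simp add: mix_def)

lemma dim_pauli [simp]: "dim_row (pauli k) = 2" "dim_col (pauli k) = 2"
  by (simp_all add: pauli_def mat_of_rows_list_def)

lemma index_pauli:
  "pauli 1 $$ (0,0) = 0" "pauli 1 $$ (0,1) = 1" "pauli 1 $$ (1,0) = 1" "pauli 1 $$ (1,1) = 0"
  "pauli 2 $$ (0,0) = 0" "pauli 2 $$ (0,1) = -\<i>" "pauli 2 $$ (1,0) = \<i>" "pauli 2 $$ (1,1) = 0"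
  "pauli 3 $$ (0,0) = 1" "pauli 3 $$ (0,1) = 0" "pauli 3 $$ (1,0) = 0" "pauli 3 $$ (1,1) = -1"
  by (simp_all add: pauli_def mat_of_rows_list_def)

lemma kron_pauli_carrier [simp]: "kron (pauli k) (pauli l) \<in> carrier_mat 4 4"
  by (rule carrier_matI) (simp_all add: kron_def)

lemma dim_kron_pauli [simp]:
  "dim_row (kron (pauli k) (pauli l)) = 4" "dim_col (kron (pauli k) (pauli l)) = 4"
  by (simp_all add: kron_def)

lemma index_kron_pauli:
  "r < 4 \<Longrightarrow> s < 4 \<Longrightarrow> kron (pauli k) (pauli l) $$ (r, s)
    = pauli k $$ (r div 2, s div 2) * pauli l $$ (r mod 2, s mod 2)"
  by (simp add: kron_def)

section \<open>The correlation sum in terms of traces\<close>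

lemma corr_hermitian:
  assumes \<rho>: "\<rho> \<in> carrier_mat 4 4"
    and h: "\<forall>r<4. \<forall>s<4. \<rho> $$ (s, r) = cnj (\<rho> $$ (r, s))"
  shows "corr \<rho> 1 1 = 2 * (Re (\<rho> $$ (0,3)) + Re (\<rho> $$ (1,2)))"
    and "corr \<rho> 1 2 = 2 * (Im (\<rho> $$ (1,2)) - Im (\<rho> $$ (0,3)))"
    and "corr \<rho> 1 3 = 2 * (Re (\<rho> $$ (0,2)) - Re (\<rho> $$ (1,3)))"
    and "corr \<rho> 2 1 = - 2 * (Im (\<rho> $$ (0,3)) + Im (\<rho> $$ (1,2)))"
    and "corr \<rho> 2 2 = 2 * (Re (\<rho> $$ (1,2)) - Re (\<rho> $$ (0,3)))"
    and "corr \<rho> 2 3 = 2 * (Im (\<rho> $$ (1,3)) - Im (\<rho> $$ (0,2)))"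
    and "corr \<rho> 3 1 = 2 * (Re (\<rho> $$ (0,1)) - Re (\<rho> $$ (2,3)))"
    and "corr \<rho> 3 2 = 2 * (Im (\<rho> $$ (2,3)) - Im (\<rho> $$ (0,1)))"
    and "corr \<rho> 3 3 = Re (\<rho> $$ (0,0)) - Re (\<rho> $$ (1,1)) - Re (\<rho> $$ (2,2)) + Re (\<rho> $$ (3,3))"
proof -
  have c: "corr \<rho> k l = Re (\<Sum>r<4. \<Sum>s<4. \<rho> $$ (r, s) * kron (pauli k) (pauli l) $$ (s, r))"
    for k l
    using \<rho> by (simp add: corr_def mtrace_def scalar_prod_def atLeast0LessThan)
  have h': "\<rho> $$ (1,0) = cnj (\<rho> $$ (0,1))" "\<rho> $$ (2,0) = cnj (\<rho> $$ (0,2))"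
    "\<rho> $$ (3,0) = cnj (\<rho> $$ (0,3))" "\<rho> $$ (2,1) = cnj (\<rho> $$ (1,2))"
    "\<rho> $$ (3,1) = cnj (\<rho> $$ (1,3))" "\<rho> $$ (3,2) = cnj (\<rho> $$ (2,3))"
    by (rule h[rule_format]; simp)+
  note defs = sum_lessThan_4 index_kron_pauli index_pauli index_pauli[simplified] h' h'[simplified]
  show "corr \<rho> 1 1 = 2 * (Re (\<rho> $$ (0,3)) + Re (\<rho> $$ (1,2)))" by (subst c) (simp_all add: defs)
  show "corr \<rho> 1 2 = 2 * (Im (\<rho> $$ (1,2)) - Im (\<rho> $$ (0,3)))" by (subst c) (simp_all add: defs)
  show "corr \<rho> 1 3 = 2 * (Re (\<rho> $$ (0,2)) - Re (\<rho> $$ (1,3)))" by (subst c) (simp_all add: defs)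
  show "corr \<rho> 2 1 = - 2 * (Im (\<rho> $$ (0,3)) + Im (\<rho> $$ (1,2)))" by (subst c) (simp_all add: defs)
  show "corr \<rho> 2 2 = 2 * (Re (\<rho> $$ (1,2)) - Re (\<rho> $$ (0,3)))" by (subst c) (simp_all add: defs)
  show "corr \<rho> 2 3 = 2 * (Im (\<rho> $$ (1,3)) - Im (\<rho> $$ (0,2)))" by (subst c) (simp_all add: defs)
  show "corr \<rho> 3 1 = 2 * (Re (\<rho> $$ (0,1)) - Re (\<rho> $$ (2,3)))" by (subst c) (simp_all add: defs)
  show "corr \<rho> 3 2 = 2 * (Im (\<rho> $$ (2,3)) - Im (\<rho> $$ (0,1)))" by (subst c) (simp_all add: defs)
  show "corr \<rho> 3 3 = Re (\<rho> $$ (0,0)) - Re (\<rho> $$ (1,1)) - Re (\<rho> $$ (2,2)) + Re (\<rho> $$ (3,3))"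
    by (subst c) (simp_all add: defs)
qed

text \<open>The right-hand side is 2 Tr(rho rho~) + 2 Tr(rho^2) - (Tr rho)^2 with rho~ = Y rho^* Y.
  Spin flip negates the local Bloch vectors and keeps the correlations, so the local terms cancel in
  the sum of the first two traces.\<close>

lemma S_val_hermitian:
  assumes \<rho>: "\<rho> \<in> carrier_mat 4 4"
    and h: "\<forall>r<4. \<forall>s<4. \<rho> $$ (s, r) = cnj (\<rho> $$ (r, s))"
  shows "S_val \<rho> = 2 * (\<Sum>r<4. \<Sum>s<4. flip_sign r * flip_sign s * Re (\<rho> $$ (r, s) * \<rho> $$ (3 - r, 3 - s)))
     + 2 * (\<Sum>r<4. \<Sum>s<4. (cmod (\<rho> $$ (r, s)))\<^sup>2) - (\<Sum>r<4. Re (\<rho> $$ (r, r)))\<^sup>2"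
proof -
  have i: "{1..3} = {1,2,3::nat}" by auto
  have d: "Im (\<rho> $$ (r, r)) = 0" if "r < 4" for r
    using h[rule_format, OF that that] by (simp add: complex_eq_iff)
  have d': "Im (\<rho> $$ (0,0)) = 0" "Im (\<rho> $$ (1,1)) = 0" "Im (\<rho> $$ (2,2)) = 0" "Im (\<rho> $$ (3,3)) = 0"
    by (auto intro!: d)
  have h': "\<rho> $$ (1,0) = cnj (\<rho> $$ (0,1))" "\<rho> $$ (2,0) = cnj (\<rho> $$ (0,2))"
    "\<rho> $$ (3,0) = cnj (\<rho> $$ (0,3))" "\<rho> $$ (2,1) = cnj (\<rho> $$ (1,2))"
    "\<rho> $$ (3,1) = cnj (\<rho> $$ (1,3))" "\<rho> $$ (3,2) = cnj (\<rho> $$ (2,3))"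
    by (rule h[rule_format]; simp)+
  have s: "(\<Sum>k\<in>{1,2,3}. f k) = f 1 + f 2 + f 3" for f :: "nat \<Rightarrow> real" by simp
  have n: "3 - (0::nat) = 3" "3 - (1::nat) = 2" "3 - (2::nat) = 1" "3 - (3::nat) = 0" by simp_all
  have f: "flip_sign 0 = -1" "flip_sign 1 = 1" "flip_sign 2 = 1" "flip_sign 3 = -1"
    by (simp_all add: flip_sign_def)
  show ?thesis
    unfolding S_val_def i s corr_hermitian[OF \<rho> h] sum_lessThan_4 n f h' cmod_power2
      complex_cnj times_complex.sel complex_cnj_cnj cnj.sel d'
    by (simp add: power2_eq_square algebra_simps)
qed

text \<open>By cyclicity of the trace, Tr(rho rho~) and Tr(rho^2) become the squared Frobenius norms
  of M and of the Gram matrix of the columns.\<close>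

lemma S_val_mix:
  "S_val (mix u) = 2 * (\<Sum>c<2. \<Sum>d<2. (cmod (spin_form (u c) (u d)))\<^sup>2)
    + 2 * (\<Sum>c<2. \<Sum>d<2. (cmod (overlap (u c) (u d)))\<^sup>2)
    - (\<Sum>c<2. \<Sum>r<4. (cmod (u c r))\<^sup>2)\<^sup>2"
proof -
  let ?\<rho> = "mix u"
  note e = index_mix
  have 1: "(\<Sum>r<4. \<Sum>s<4. of_real (flip_sign r * flip_sign s) * (?\<rho> $$ (r, s) * ?\<rho> $$ (3 - r, 3 - s))) =
     (\<Sum>c<2. \<Sum>d<2. spin_form (u c) (u d) * cnj (spin_form (u c) (u d)))"
    by (simp add: sum_lessThan_4 e flip_sign_def spin_form_eq sum_lessThan_2 algebra_simps)
  have 2: "(\<Sum>r<4. \<Sum>s<4. ?\<rho> $$ (r, s) * cnj (?\<rho> $$ (r, s))) =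
     (\<Sum>c<2. \<Sum>d<2. overlap (u c) (u d) * cnj (overlap (u c) (u d)))"
    by (simp add: sum_lessThan_4 e overlap_def sum_lessThan_2 algebra_simps)
  have 3: "(\<Sum>r<4. ?\<rho> $$ (r, r)) = (\<Sum>c<2. \<Sum>r<4. u c r * cnj (u c r))"
    by (simp add: sum_lessThan_4 e sum_lessThan_2 algebra_simps)
  have Re_mult_real: "Re (of_real x * z) = x * Re z" for x z by simp
  have 1: "(\<Sum>r<4. \<Sum>s<4. flip_sign r * flip_sign s * Re (?\<rho> $$ (r, s) * ?\<rho> $$ (3 - r, 3 - s))) =
     (\<Sum>c<2. \<Sum>d<2. (cmod (spin_form (u c) (u d)))\<^sup>2)"
    using arg_cong[OF 1, of Re] by (simp only: complex_norm_square[symmetric] Re_sum Re_complex_of_real Re_mult_real)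
  have 2: "(\<Sum>r<4. \<Sum>s<4. (cmod (?\<rho> $$ (r, s)))\<^sup>2) = (\<Sum>c<2. \<Sum>d<2. (cmod (overlap (u c) (u d)))\<^sup>2)"
    using arg_cong[OF 2, of Re] by (simp only: complex_norm_square[symmetric] Re_sum Re_complex_of_real)
  have 3: "(\<Sum>r<4. Re (?\<rho> $$ (r, r))) = (\<Sum>c<2. \<Sum>r<4. (cmod (u c r))\<^sup>2)"
    using arg_cong[OF 3, of Re] by (simp only: complex_norm_square[symmetric] Re_sum Re_complex_of_real)
  have "\<forall>r<4. \<forall>s<4. ?\<rho> $$ (s, r) = cnj (?\<rho> $$ (r, s))"
    by (simp add: e mult.commute)
  from S_val_hermitian[OF mix_carrier this] show ?thesis
    by (simp only: 1 2 3)
qed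

section \<open>Concurrence and eigenvalue bounds\<close>

lemma spin_flip_carrier: "\<rho> \<in> carrier_mat 4 4 \<Longrightarrow> spin_flip_prod \<rho> \<in> carrier_mat 4 4"
  by (auto simp: spin_flip_prod_def kron_def pauli_def mat_of_rows_list_def)

text \<open>Every lambda lies in [0, sqrt b], so subtracting three of them from a fourth leaves at
  most sqrt b.\<close>

lemma concurrence_sq_le:
  assumes \<rho>: "\<rho> \<in> carrier_mat 4 4"
    and ev: "\<And>z. eigenvalue (spin_flip_prod \<rho>) z \<Longrightarrow> 0 \<le> Re z \<and> Re z \<le> b"
  shows "(concurrence \<rho>)\<^sup>2 \<le> b"
proof -
  let ?R = "spin_flip_prod \<rho>" and ?l = "wootters_lambdas \<rho>"
  have R: "?R \<in> carrier_mat 4 4" using \<rho> by (rule spin_flip_carrier)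
  have deg: "degree (char_poly ?R) = 4" using degree_monic_char_poly[OF R] by simp
  then have ne: "char_poly ?R \<noteq> 0" by auto
  \<comment> \<open>A complex polynomial of degree 4 has 4 roots with multiplicity, so the list
    accesses in \<open>concurrence\<close> are in range.\<close>
  have "size (mset ?l) = 4"
    by (simp add: wootters_lambdas_def size_proots_complex deg del: size_mset)
  then have len: "length ?l = 4" by simp
  have mem: "0 \<le> x \<and> x \<le> sqrt b" if x: "x \<in> set ?l" for x
  proof -
    from x have "x \<in># mset ?l" by simp
    then obtain z where "poly (char_poly ?R) z = 0" "x = sqrt (Re z)"
      by (auto simp: wootters_lambdas_def ne simp del: set_mset_mset)
    with ev[of z] show ?thesis by (simp add: eigenvalue_root_char_poly[OF R])
  qed
  have n: "0 \<le> ?l ! k \<and> ?l ! k \<le> sqrt b" if "k < 4" for k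
    using that len by (intro mem) simp
  have c: "0 \<le> concurrence \<rho>" "concurrence \<rho> \<le> sqrt b"
    using n[of 0] n[of 1] n[of 2] n[of 3] by (simp_all add: concurrence_def Let_def del: real_sqrt_ge_0_iff)
  \<comment> \<open>The chain \<open>c\<close> also gives \<open>0 \<le> sqrt b\<close>, hence
    \<open>b \<ge> 0\<close>, and sqrt b squares to b.\<close>
  from power_mono[OF c(2,1), of 2] order_trans[OF c] show ?thesis by simp
qed

section \<open>Eigenvalues of the spin-flip product\<close>

lemma mix_mult_vec:
  assumes "w \<in> carrier_vec 4" "r < 4"
  shows "(mix u *\<^sub>v w) $ r = (\<Sum>c<2. u c r * (\<Sum>s<4. cnj (u c s) * w $ s))"
proof -
  have "(mix u *\<^sub>v w) $ r = (\<Sum>s<4. mix u $$ (r, s) * w $ s)"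
    using assms by (simp add: scalar_prod_def atLeast0LessThan mix_def)
  then show ?thesis
    using assms by (simp add: index_mix sum_lessThan_2 sum_lessThan_4 algebra_simps)
qed

lemma sigma22_mult_vec:
  assumes "w \<in> carrier_vec 4" "r < 4"
  shows "(kron (pauli 2) (pauli 2) *\<^sub>v w) $ r = of_real (flip_sign r) * w $ (3 - r)"
proof -
  have "r = 0 \<or> r = 1 \<or> r = 2 \<or> r = 3" using assms by auto
  then show ?thesis
    using assms by (elim disjE) (auto simp: scalar_prod_def atLeast0LessThan sum_lessThan_4 index_kron_pauli index_pauli index_pauli[simplified] flip_sign_def)
qed

lemma map_cnj_mix: "map_mat cnj (mix u) = mix (\<lambda>c r. cnj (u c r))"
  by (rule eq_matI) (auto simp: mix_def)

text \<open>The product factors as U M^* U^T Y, so its range lies in the span of the two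
  columns.\<close>

lemma spin_flip_mult_vec:
  assumes v: "v \<in> carrier_vec 4" and r: "r < 4"
  shows "(spin_flip_prod (mix u) *\<^sub>v v) $ r =
    (\<Sum>d<2. u d r * (\<Sum>c<2. cnj (spin_form (u d) (u c)) * spin_form (u c) (\<lambda>s. v $ s)))"
proof -
  let ?Y = "kron (pauli 2) (pauli 2)" and ?\<rho>' = "mix (\<lambda>c r. cnj (u c r))"
  have Y: "?Y \<in> carrier_mat 4 4" by simp
  have 1: "spin_flip_prod (mix u) *\<^sub>v v = mix u *\<^sub>v (?Y *\<^sub>v (?\<rho>' *\<^sub>v (?Y *\<^sub>v v)))"
    unfolding spin_flip_prod_def map_cnj_mix
    by (simp add: assoc_mult_mat_vec[of _ 4 4 _ 4] mult_carrier_mat[of _ 4 4 _ 4] mult_mat_vec_carrier[of _ 4 4] Y v)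
  have a: "(?\<rho>' *\<^sub>v (?Y *\<^sub>v v)) $ s = (\<Sum>c<2. cnj (u c s) * spin_form (u c) (\<lambda>s. v $ s))" if "s < 4" for s
    using that v Y by (subst mix_mult_vec) (auto simp del: index_mult_mat_vec simp: spin_form_def sigma22_mult_vec mult_ac intro!: mult_mat_vec_carrier[of _ 4 4])
  have b: "(?Y *\<^sub>v (?\<rho>' *\<^sub>v (?Y *\<^sub>v v))) $ s = of_real (flip_sign s) * (\<Sum>c<2. cnj (u c (3 - s)) * spin_form (u c) (\<lambda>s. v $ s))" if "s < 4" for s
    using that v Y by (subst sigma22_mult_vec) (auto simp del: index_mult_mat_vec simp: a intro!: mult_mat_vec_carrier[of _ 4 4])
  have e: "(\<Sum>s<4. cnj (u d s) * (of_real (flip_sign s) * (\<Sum>c<2. cnj (u c (3 - s)) * y c)))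
      = (\<Sum>c<2. cnj (spin_form (u d) (u c)) * y c)" for d and y :: "nat \<Rightarrow> complex"
    by (simp add: spin_form_def sum_distrib_left sum_distrib_right mult_ac sum.swap[of _ "{..<4}"])
  have "(mix u *\<^sub>v (?Y *\<^sub>v (?\<rho>' *\<^sub>v (?Y *\<^sub>v v)))) $ r =
    (\<Sum>d<2. u d r * (\<Sum>s<4. cnj (u d s) * (?Y *\<^sub>v (?\<rho>' *\<^sub>v (?Y *\<^sub>v v))) $ s))"
    using r v Y by (intro mix_mult_vec mult_mat_vec_carrier[of _ 4 4]) simp_all
  then show ?thesis unfolding 1 by (simp add: b e del: index_mult_mat_vec)
qed

text \<open>An eigenvector for a nonzero z is U x for some x, and z becomes the Rayleigh quotient of
  M^* M at x, with M symmetric; this also makes z real and nonnegative.\<close>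

lemma spin_flip_mix_eigenvalue:
  assumes "eigenvalue (spin_flip_prod (mix u)) z" "z \<noteq> 0"
  obtains x y where "x \<noteq> 0 \<or> y \<noteq> 0"
    "z * of_real ((cmod x)\<^sup>2 + (cmod y)\<^sup>2) =
      of_real (\<Sum>c<2. (cmod (spin_form (u c) (\<lambda>r. u 0 r * x + u 1 r * y)))\<^sup>2)"
proof -
  have R: "spin_flip_prod (mix u) \<in> carrier_mat 4 4" by (simp add: spin_flip_carrier)
  with assms obtain v where v: "v \<in> carrier_vec 4" "v \<noteq> 0\<^sub>v 4" "spin_flip_prod (mix u) *\<^sub>v v = z \<cdot>\<^sub>v v"
    by (auto simp: eigenvalue_def eigenvector_def)
  define y where "y c = spin_form (u c) (\<lambda>s. v $ s)" for c
  \<comment> \<open>Coefficients of \<open>v\<close> read off from R v = z v; the columns may be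
    linearly dependent, so this fixes one choice.\<close>
  define x where "x d = (\<Sum>c<2. cnj (spin_form (u d) (u c)) * y c) / z" for d
  have vr: "v $ r = u 0 r * x 0 + u 1 r * x 1" if r: "r < 4" for r
  proof -
    have "z * v $ r = (spin_flip_prod (mix u) *\<^sub>v v) $ r"
      using v r by simp
    also have "\<dots> = (\<Sum>d<2. u d r * (z * x d))"
      unfolding spin_flip_mult_vec[OF v(1) r] using \<open>z \<noteq> 0\<close> by (simp add: x_def y_def)
    also have "\<dots> = z * (u 0 r * x 0 + u 1 r * x 1)"
      by (simp add: sum_lessThan_2 algebra_simps)
    finally show ?thesis using \<open>z \<noteq> 0\<close> by simp
  qed
  have yc: "y c = spin_form (u c) (\<lambda>r. u 0 r * x 0 + u 1 r * x 1)" for c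
    unfolding y_def spin_form_eq by (simp add: vr vr[of 1, simplified])
  have "x 0 \<noteq> 0 \<or> x 1 \<noteq> 0"
  proof (rule ccontr)
    assume "\<not> ?thesis"
    then have "v = 0\<^sub>v 4" using v(1) by (intro eq_vecI) (auto simp: vr)
    with v show False by simp
  qed
  moreover have "z * of_real ((cmod (x 0))\<^sup>2 + (cmod (x 1))\<^sup>2) = of_real (\<Sum>c<2. (cmod (y c))\<^sup>2)"
  proof -
    have zx: "z * x d = (\<Sum>c<2. cnj (spin_form (u d) (u c)) * y c)" for d
      using \<open>z \<noteq> 0\<close> by (simp add: x_def)
    have "z * of_real ((cmod (x 0))\<^sup>2 + (cmod (x 1))\<^sup>2) = cnj (x 0) * (z * x 0) + cnj (x 1) * (z * x 1)"
      by (simp add: complex_norm_square algebra_simps del: of_real_power)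
    \<comment> \<open>Symmetry of \<open>spin_form\<close> moves M over to the vector x.\<close>
    also have "\<dots> = (\<Sum>c<2. y c * cnj (spin_form (u c) (\<lambda>r. u 0 r * x 0 + u 1 r * x 1)))"
      unfolding zx sum_lessThan_2 spin_form_eq by (simp add: algebra_simps)
    also have "\<dots> = of_real (\<Sum>c<2. (cmod (y c))\<^sup>2)"
      by (simp only: of_real_sum complex_norm_square yc[symmetric])
    finally show ?thesis .
  qed
  ultimately show ?thesis using that[of "x 0" "x 1"] unfolding yc by blast
qed

section \<open>Operator and Frobenius norm bounds\<close>

text \<open>The hypotheses say that k I minus the Gram matrix has nonnegative diagonal and
  determinant, so this 2 x 2 matrix is positive semidefinite.\<close>

lemma norm_superposition_le:
  fixes u :: "nat \<Rightarrow> nat \<Rightarrow> complex"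
  defines "N \<equiv> \<lambda>c. \<Sum>r<4. (cmod (u c r))\<^sup>2"
  assumes N: "N 0 \<le> k" "N 1 \<le> k"
    and w: "(cmod (overlap (u 0) (u 1)))\<^sup>2 \<le> (k - N 0) * (k - N 1)"
  shows "(\<Sum>r<4. (cmod (u 0 r * x + u 1 r * y))\<^sup>2) \<le> k * ((cmod x)\<^sup>2 + (cmod y)\<^sup>2)"
proof -
  let ?w = "overlap (u 0) (u 1)" and ?a = "sqrt (k - N 0)" and ?b = "sqrt (k - N 1)"
  have sq: "(cmod (p + q))\<^sup>2 = (cmod p)\<^sup>2 + (cmod q)\<^sup>2 + 2 * Re (cnj p * q)" for p q
    unfolding cmod_power2 by (simp add: power2_eq_square algebra_simps)
  have "(\<Sum>r<4. (cmod (u 0 r * x + u 1 r * y))\<^sup>2) =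
      N 0 * (cmod x)\<^sup>2 + N 1 * (cmod y)\<^sup>2 + 2 * Re (\<Sum>r<4. cnj (u 0 r * x) * (u 1 r * y))"
    by (simp only: sq N_def sum.distrib sum_distrib_left sum_distrib_right norm_mult power_mult_distrib Re_sum)
  also have "(\<Sum>r<4. cnj (u 0 r * x) * (u 1 r * y)) = ?w * (cnj x * y)"
    by (simp add: overlap_def sum_distrib_left sum_distrib_right mult_ac)
  also have "Re (?w * (cnj x * y)) \<le> cmod ?w * (cmod x * cmod y)"
    by (rule order_trans[OF complex_Re_le_cmod]) (simp add: norm_mult)
  also have "\<dots> \<le> (?a * ?b) * (cmod x * cmod y)"
    using real_le_rsqrt[OF w] by (intro mult_right_mono) (simp_all add: real_sqrt_mult)
  also have "N 0 * (cmod x)\<^sup>2 + N 1 * (cmod y)\<^sup>2 + 2 * ((?a * ?b) * (cmod x * cmod y))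
      = k * ((cmod x)\<^sup>2 + (cmod y)\<^sup>2) - (?a * cmod x - ?b * cmod y)\<^sup>2"
    using N by (simp add: power2_diff power_mult_distrib algebra_simps)
  finally show ?thesis by (smt (verit) zero_le_power2)
qed

text \<open>Y is a signed permutation and U^T has the operator norm of U, so U^T Y inherits the
  bound.\<close>

lemma spin_form_norm_le:
  fixes u :: "nat \<Rightarrow> nat \<Rightarrow> complex"
  assumes k: "k > 0"
    and u: "\<And>x y. (\<Sum>r<4. (cmod (u 0 r * x + u 1 r * y))\<^sup>2) \<le> k * ((cmod x)\<^sup>2 + (cmod y)\<^sup>2)"
  shows "(\<Sum>c<2. (cmod (spin_form (u c) w))\<^sup>2) \<le> k * (\<Sum>r<4. (cmod (w r))\<^sup>2)"
proof -
  define y where "y c = spin_form (u c) w" for c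
  \<comment> \<open>Duality witness: U applied to the conjugate of y, so that the squared norm of y
    equals \<open>spin_form p w\<close>.\<close>
  define p where "p r = u 0 r * cnj (y 0) + u 1 r * cnj (y 1)" for r
  let ?Y = "\<Sum>c<2. (cmod (y c))\<^sup>2"
  \<comment> \<open>The weight k turns the bound on \<open>p\<close> into half of the left-hand
    side, which is then absorbed.\<close>
  have am_gm: "cmod (a * b) \<le> (cmod a)\<^sup>2 / (2 * k) + k / 2 * (cmod b)\<^sup>2" for a b
  proof -
    have "0 \<le> (cmod a - k * cmod b)\<^sup>2 / (2 * k)" using k by simp
    then show ?thesis using k by (simp add: power2_eq_square norm_mult field_simps)
  qed
  have Y: "complex_of_real ?Y = spin_form p w"
    unfolding p_def sum_lessThan_2 of_real_add complex_norm_square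
    by (simp add: y_def spin_form_eq algebra_simps)
  have "?Y = \<bar>?Y\<bar>" by (simp add: sum_nonneg)
  also have "\<dots> = cmod (spin_form p w)"
    unfolding Y[symmetric] norm_of_real ..
  also have "\<dots> \<le> (\<Sum>r<4. cmod (p r * w (3 - r)))"
    unfolding spin_form_def by (rule order_trans[OF norm_sum]) (simp add: flip_sign_def norm_mult sum_lessThan_4)
  also have "\<dots> \<le> (\<Sum>r<4. (cmod (p r))\<^sup>2 / (2 * k) + k / 2 * (cmod (w (3 - r)))\<^sup>2)"
    by (intro sum_mono am_gm)
  also have "\<dots> = (\<Sum>r<4. (cmod (p r))\<^sup>2) / (2 * k) + k / 2 * (\<Sum>r<4. (cmod (w r))\<^sup>2)"
    by (simp add: sum_lessThan_4 algebra_simps add_divide_distrib)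
  also have "(\<Sum>r<4. (cmod (p r))\<^sup>2) / (2 * k) \<le> (k * ?Y) / (2 * k)"
    using u[of "cnj (y 0)" "cnj (y 1)"] k by (intro divide_right_mono) (simp_all add: p_def sum_lessThan_2)
  finally show ?thesis using k by (simp add: y_def)
qed

lemma spin_form_le_frobenius:
  fixes u :: "nat \<Rightarrow> nat \<Rightarrow> complex"
  shows "(\<Sum>c<2. (cmod (spin_form (u c) (\<lambda>r. u 0 r * x + u 1 r * y)))\<^sup>2)
    \<le> (\<Sum>c<2. \<Sum>d<2. (cmod (spin_form (u c) (u d)))\<^sup>2) * ((cmod x)\<^sup>2 + (cmod y)\<^sup>2)"
proof -
  have cs: "(cmod (a * x + b * y))\<^sup>2 \<le> ((cmod a)\<^sup>2 + (cmod b)\<^sup>2) * ((cmod x)\<^sup>2 + (cmod y)\<^sup>2)" for a b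
  proof -
    have "(cmod (a * x + b * y))\<^sup>2 \<le> (cmod a * cmod x + cmod b * cmod y)\<^sup>2"
      by (intro power_mono) (metis norm_mult norm_triangle_ineq, simp)
    \<comment> \<open>Lagrange's identity, which yields Cauchy-Schwarz for each row of M.\<close>
    also have "\<dots> = ((cmod a)\<^sup>2 + (cmod b)\<^sup>2) * ((cmod x)\<^sup>2 + (cmod y)\<^sup>2) - (cmod a * cmod y - cmod b * cmod x)\<^sup>2"
      by (simp add: power2_eq_square algebra_simps)
    finally show ?thesis by (smt (verit) zero_le_power2)
  qed
  have lin: "spin_form v (\<lambda>r. u 0 r * x + u 1 r * y) = spin_form v (u 0) * x + spin_form v (u 1) * y" for v
    by (simp add: spin_form_eq algebra_simps)
  show ?thesis
    unfolding lin sum_lessThan_2 distrib_right[of "_ + _" "_ + _"] by (intro add_mono cs)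
qed

text \<open>A bound on the Rayleigh quotients of M^* M bounds all eigenvalues. It serves twice
  below, with b = T and with b = 4/9.\<close>

lemma concurrence_mix_sq_le:
  assumes "b \<ge> 0" and "\<And>x y. (\<Sum>c<2. (cmod (spin_form (u c) (\<lambda>r. u 0 r * x + u 1 r * y)))\<^sup>2)
    \<le> b * ((cmod x)\<^sup>2 + (cmod y)\<^sup>2)"
  shows "(concurrence (mix u))\<^sup>2 \<le> b"
proof (rule concurrence_sq_le)
  fix z assume ev: "eigenvalue (spin_flip_prod (mix u)) z"
  show "0 \<le> Re z \<and> Re z \<le> b"
  proof (cases "z = 0")
    case False
    from spin_flip_mix_eigenvalue[OF ev this] obtain x y where xy: "x \<noteq> 0 \<or> y \<noteq> 0"
      and z: "z * of_real ((cmod x)\<^sup>2 + (cmod y)\<^sup>2) =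
      of_real (\<Sum>c<2. (cmod (spin_form (u c) (\<lambda>r. u 0 r * x + u 1 r * y)))\<^sup>2)" by blast
    let ?n = "(cmod x)\<^sup>2 + (cmod y)\<^sup>2" and ?f = "\<Sum>c<2. (cmod (spin_form (u c) (\<lambda>r. u 0 r * x + u 1 r * y)))\<^sup>2"
    have n: "?n > 0" using xy by (auto simp: sum_power2_gt_zero_iff)
    have "Re z * ?n = ?f" using arg_cong[OF z, of Re] by (simp only: Re_complex_of_real) simp
    then have "Re z = ?f / ?n" using n by (metis less_irrefl nonzero_eq_divide_eq)
    moreover have "?f / ?n \<le> b" using assms(2)[of x y] n by (simp add: pos_divide_le_eq)
    moreover have "0 \<le> ?f / ?n" by (intro divide_nonneg_nonneg sum_nonneg) auto
    ultimately show ?thesis by simp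
  qed (use assms in simp)
qed simp

lemma S_val_mix_gt_1:
  assumes norm: "(\<Sum>c<2. \<Sum>r<4. (cmod (u c r))\<^sup>2) = 1"
    and C: "(concurrence (mix u))\<^sup>2 > 4 / 9"
  shows "S_val (mix u) > 1"
proof -
  define N where "N c = (\<Sum>r<4. (cmod (u c r))\<^sup>2)" for c
  define W where "W = (cmod (overlap (u 0) (u 1)))\<^sup>2"
  let ?T = "\<Sum>c<2. \<Sum>d<2. (cmod (spin_form (u c) (u d)))\<^sup>2"
  have N1: "N 1 = 1 - N 0" using norm by (simp add: N_def sum_lessThan_2)
  have "(concurrence (mix u))\<^sup>2 \<le> ?T"
    by (intro concurrence_mix_sq_le spin_form_le_frobenius sum_nonneg) auto
  with C have T: "?T > 4 / 9" by simp
  \<comment> \<open>The left-hand side is the squared Bloch length, the squared gap between the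
    eigenvalues of the Gram matrix.\<close>
  have c: "(N 0 - N 1)\<^sup>2 + 4 * W > 1 / 9"
  proof (rule ccontr)
    assume "\<not> ?thesis"
    then have le: "(N 0 - N 1)\<^sup>2 + 4 * W \<le> (1 / 3)\<^sup>2" by (simp add: power2_eq_square)
    have "W \<ge> 0" by (simp add: W_def)
    with le have "\<bar>N 0 - N 1\<bar> \<le> 1 / 3" using abs_le_square_iff[of "N 0 - N 1" "1 / 3"] by simp
    then have N: "N 0 \<le> 2 / 3" "N 1 \<le> 2 / 3" using N1 unfolding abs_le_iff by linarith+
    \<comment> \<open>As N 0 + N 1 = 1, the right side minus W is a quarter of 1/9 minus the squared
      Bloch length.\<close>
    have W: "W \<le> (2 / 3 - N 0) * (2 / 3 - N 1)"
      using le unfolding N1 by (simp add: power2_eq_square algebra_simps)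
    have u: "(\<Sum>r<4. (cmod (u 0 r * x + u 1 r * y))\<^sup>2) \<le> 2 / 3 * ((cmod x)\<^sup>2 + (cmod y)\<^sup>2)" for x y
      using N W unfolding N_def W_def by (rule norm_superposition_le)
    have "(concurrence (mix u))\<^sup>2 \<le> 4 / 9"
    proof (rule concurrence_mix_sq_le)
      fix x y
      \<comment> \<open>The factor 2/3 enters twice, once for U^T Y and once for U, giving
        4/9.\<close>
      have "(\<Sum>c<2. (cmod (spin_form (u c) (\<lambda>r. u 0 r * x + u 1 r * y)))\<^sup>2)
        \<le> 2 / 3 * (\<Sum>r<4. (cmod (u 0 r * x + u 1 r * y))\<^sup>2)"
        by (rule spin_form_norm_le) (use u in auto)
      with u[of x y] show "(\<Sum>c<2. (cmod (spin_form (u c) (\<lambda>r. u 0 r * x + u 1 r * y)))\<^sup>2)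
        \<le> 4 / 9 * ((cmod x)\<^sup>2 + (cmod y)\<^sup>2)" by linarith
    qed simp
    with C show False by simp
  qed
  have self: "overlap v v = of_real (\<Sum>r<4. (cmod (v r))\<^sup>2)" for v
    by (simp add: overlap_def complex_norm_square mult.commute del: of_real_power)
  have "overlap (u 1) (u 0) = cnj (overlap (u 0) (u 1))"
    by (simp add: overlap_def mult.commute)
  then have "(cmod (overlap (u 1) (u 0)))\<^sup>2 = W" by (simp add: W_def)
  then have "(\<Sum>c<2. \<Sum>d<2. (cmod (overlap (u c) (u d)))\<^sup>2) = (N 0)\<^sup>2 + (N 1)\<^sup>2 + 2 * W"
    unfolding sum_lessThan_2 self norm_of_real power2_abs N_def[symmetric] W_def[symmetric] by simp
  \<comment> \<open>The subtracted 1 is (N 0 + N 1)^2, which leaves the squared Bloch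
    length.\<close>
  then have "S_val (mix u) = 2 * ?T + ((N 0 - N 1)\<^sup>2 + 4 * W)"
    unfolding S_val_mix norm N1 by (simp add: power2_eq_square algebra_simps)
  with T c show ?thesis by simp
qed

section \<open>Reduced states of a three-qubit vector\<close>

lemma reduced2_mix:
  "reduced2 \<psi> i j = mix (\<lambda>c r. \<psi> $ idx3 i j (r div 2) (r mod 2) c)"
  by (simp add: reduced2_def mix_def)

text \<open>The traced-out qubit is 3 - i - j, so the indices run once through all eight basis
  states.\<close>

lemma sum_idx3:
  assumes "i \<in> {0, 1, 2}" "j \<in> {0, 1, 2}" "i \<noteq> j"
  shows "(\<Sum>c<2. \<Sum>r<4. f (idx3 i j (r div 2) (r mod 2) c)) = (\<Sum>k<8. f k :: real)"
proof -
  have "(\<Sum>k<8. f k) = f 0 + f 1 + f 2 + f 3 + f 4 + f 5 + f 6 + f 7"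
    by (simp add: eval_nat_numeral)
  then show ?thesis
    using assms by (auto simp: sum_lessThan_2 sum_lessThan_4 idx3_def) (simp_all add: numeral_3_eq_3)
qed

theorem theorem3:
  fixes \<psi> :: "complex vec" and i j :: nat
  assumes "pure_three_qubit \<psi>"
    and "i \<in> {0, 1, 2}" and "j \<in> {0, 1, 2}" and "i \<noteq> j"
    and "(concurrence (reduced2 \<psi> i j))\<^sup>2 > 4 / 9"
  shows "S_val (reduced2 \<psi> i j) > 1"
proof -
  have "(\<Sum>c<2. \<Sum>r<4. (cmod (\<psi> $ idx3 i j (r div 2) (r mod 2) c))\<^sup>2) = 1"
    using sum_idx3[OF assms(2-4), of "\<lambda>k. (cmod (\<psi> $ k))\<^sup>2"] assms(1)
    by (simp add: pure_three_qubit_def)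
  with assms(5) show ?thesis
    unfolding reduced2_mix by (intro S_val_mix_gt_1)
qed
end
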